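(* Let $f\in\mathcal{A}$. Then $\|\tau_xf-f\|\to 0$ as $x\to 0$.
   Context: Let $\mathcal{D}=C_c^\infty(\mathbb{R})$ be the space of test functions and $\mathcal{D}'$ the space of Schwartz distributions on $\mathbb{R}$. Let $\tilde{C}=\{F:\mathbb{R}\to\mathbb{R}\mid F \text{ continuous on } \mathbb{R},\ \lim_{x\to-\infty}F(x)=0,\ \lim_{x\to\infty}F(x)\in\mathbb{R}\}$. The space $\mathcal{A}$ is the set of all $f\in\mathcal{D}'$ for which there is a (necessarily unique) $F\in\tilde{C}$ with $F'=f$ in the sense of distributions, i.e. $\langle f,\phi\rangle=-\int_{-\infty}^\infty F\phi'$ for all $\phi\in\mathcal{D}$. (This is the completion, with respect to the Alexiewicz norm, of the space of Henstock--Kurzweil integrable functions on $\mathbb{R}$.) The distributional Denjoy integral of $f\in\mathcal{A}$ is $\int_a^bf=F(b)-F(a)$ for $-\infty\le a\le b\le\infty$, where $F(\pm\infty)$ denote the limits at $\pm\infty$. The Alexiewicz norm on $\mathcal{A}$ is $\|f\|=\sup_{x\in\mathbb{R}}\left|\int_{-\infty}^xf\right|=\sup_{x\in\mathbb{R}}|F(x)|$, which is equivalent to the norm $\sup_I\left|\int_If\right|$ with supremum over all intervals $I\subset\mathbb{R}$. For a function $\phi:\mathbb{R}\to\mathbb{R}$ and $x\in\mathbb{R}$, $\tau_x\phi(y)=\phi(y-x)$; for a distribution $f$, $\tau_xf$ is defined by $\langle\tau_xf,\phi\rangle=\langle f,\tau_{-x}\phi\rangle$ for all $\phi\in\mathcal{D}$.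 *)

theory Defs
  imports "HOL-Analysis.Analysis"
begin

definition test_functions :: "(real \<Rightarrow> real) set" where
  "test_functions =
     {\<phi>. (\<forall>n. (deriv ^^ n) \<phi> differentiable_on UNIV) \<and> compact (closure {x. \<phi> x \<noteq> 0})}"

definition test_tendsto :: "(nat \<Rightarrow> real \<Rightarrow> real) \<Rightarrow> (real \<Rightarrow> real) \<Rightarrow> bool" where
  "test_tendsto \<Phi> \<phi> \<longleftrightarrow>
     (\<exists>K. compact K \<and> (\<forall>n. closure {x. \<Phi> n x \<noteq> 0} \<subseteq> K)) \<and>
     (\<forall>m. uniform_limit UNIV (\<lambda>n. (deriv ^^ m) (\<Phi> n)) ((deriv ^^ m) \<phi>) sequentially)"

(* A distribution is represented as a total function on real \<Rightarrow> real that is zero off the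
   test functions, so that equality and subtraction of distributions are those of functions. *)
definition distributions :: "((real \<Rightarrow> real) \<Rightarrow> real) set" where
  "distributions =
     {T. (\<forall>\<phi>. \<phi> \<notin> test_functions \<longrightarrow> T \<phi> = 0) \<and>
         (\<forall>\<phi>\<in>test_functions. \<forall>\<psi>\<in>test_functions. \<forall>a b.
            T (\<lambda>x. a * \<phi> x + b * \<psi> x) = a * T \<phi> + b * T \<psi>) \<and>
         (\<forall>\<Phi> \<phi>. (\<forall>n. \<Phi> n \<in> test_functions) \<longrightarrow> \<phi> \<in> test_functions \<longrightarrow> test_tendsto \<Phi> \<phi> \<longrightarrow>
            (\<lambda>n. T (\<Phi> n)) \<longlonglongrightarrow> T \<phi>)}"

definition C_tilde :: "(real \<Rightarrow> real) set" where
  "C_tilde =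
     {F. continuous_on UNIV F \<and> (F \<longlongrightarrow> 0) at_bot \<and> (\<exists>L. (F \<longlongrightarrow> L) at_top)}"

definition has_dist_deriv :: "(real \<Rightarrow> real) \<Rightarrow> ((real \<Rightarrow> real) \<Rightarrow> real) \<Rightarrow> bool" where
  "has_dist_deriv F f \<longleftrightarrow>
     (\<forall>\<phi>\<in>test_functions. f \<phi> = - integral UNIV (\<lambda>x. F x * deriv \<phi> x))"

definition dist_A :: "((real \<Rightarrow> real) \<Rightarrow> real) set" where
  "dist_A = {f \<in> distributions. \<exists>F\<in>C_tilde. has_dist_deriv F f}"

definition primitive :: "((real \<Rightarrow> real) \<Rightarrow> real) \<Rightarrow> real \<Rightarrow> real" where
  "primitive f = (THE F. F \<in> C_tilde \<and> has_dist_deriv F f)"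

definition ext_val :: "(real \<Rightarrow> real) \<Rightarrow> ereal \<Rightarrow> real" where
  "ext_val F a = (case a of ereal x \<Rightarrow> F x | PInfty \<Rightarrow> Lim at_top F | MInfty \<Rightarrow> Lim at_bot F)"

definition dist_integral :: "ereal \<Rightarrow> ereal \<Rightarrow> ((real \<Rightarrow> real) \<Rightarrow> real) \<Rightarrow> real" where
  "dist_integral a b f = ext_val (primitive f) b - ext_val (primitive f) a"

definition alexiewicz_norm :: "((real \<Rightarrow> real) \<Rightarrow> real) \<Rightarrow> real" where
  "alexiewicz_norm f = (SUP x::real. \<bar>dist_integral (-\<infinity>) (ereal x) f\<bar>)"

definition translate :: "real \<Rightarrow> (real \<Rightarrow> real) \<Rightarrow> real \<Rightarrow> real" where
  "translate x \<phi> = (\<lambda>y. \<phi> (y - x))"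

definition translate_dist ::
    "real \<Rightarrow> ((real \<Rightarrow> real) \<Rightarrow> real) \<Rightarrow> (real \<Rightarrow> real) \<Rightarrow> real" where
  "translate_dist x f = (\<lambda>\<phi>. f (translate (- x) \<phi>))"

end

theory Submission
  imports Defs
begin

text \<open>
  Differentiation commutes with translation, so if \<open>F\<close> is the primitive of \<open>f\<close>, then
  \<open>y \<mapsto> F (y - x) - F y\<close> is the primitive of \<open>\<tau>\<^sub>x f - f\<close>, and the Alexiewicz norm of the latter is
  \<open>sup\<^sub>y \<bar>F (y - x) - F y\<bar>\<close>. A continuous function with finite limits at both ends of the line is
  uniformly continuous, and this says precisely that the supremum tends to \<open>0\<close> with \<open>x\<close>.

  The substance lies in the uniqueness of the primitive (\<open>has_dist_deriv_unique\<close>), without which the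
  definite description in \<open>primitive\<close> cannot be evaluated. It follows from the du Bois-Reymond lemma:
  a continuous \<open>F\<close> with zero distributional derivative is constant. Given points \<open>a\<close> and \<open>b\<close>, it is tested
  against the difference of two translates of a smooth step \<open>R\<close>. The derivative of this test function
  is a bump just right of \<open>a\<close> minus the same bump just right of \<open>b\<close>, so the averages of \<open>F\<close> against the
  two bumps agree; for narrow bumps these are close to \<open>F a\<close> and \<open>F b\<close>. Smooth bumps come from the
  function \<open>exp (- (1 / x))\<close>, extended by \<open>0\<close> to the left half-line (\<open>smooth_flat\<close>).
\<close>

section \<open>Smooth functions on the real line\<close>

text \<open>
  Derivatives are given by witnesses rather than by \<open>deriv\<close>, so that each closure property below
  is an induction whose step supplies the derivative formula.
\<close>

primrec differentiable_times :: "nat \<Rightarrow> (real \<Rightarrow> real) \<Rightarrow> bool" where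
  "differentiable_times 0 f = True"
| "differentiable_times (Suc n) f =
     (\<exists>f'. (\<forall>x. (f has_real_derivative f' x) (at x)) \<and> differentiable_times n f')"

lemma differentiable_times_decrease:
  "differentiable_times (Suc n) f \<Longrightarrow> differentiable_times n f"
proof (induction n arbitrary: f)
  case (Suc n)
  then show ?case by (metis differentiable_times.simps(2))
qed simp

lemma differentiable_times_add:
  "differentiable_times n f \<Longrightarrow> differentiable_times n g \<Longrightarrow>
     differentiable_times n (\<lambda>x. f x + g x)"
proof (induction n arbitrary: f g)
  case (Suc n)
  obtain f' g' where
    "\<forall>x. (f has_real_derivative f' x) (at x)" "differentiable_times n f'"
    "\<forall>x. (g has_real_derivative g' x) (at x)" "differentiable_times n g'"
    using Suc.prems by auto
  then show ?case
    using Suc.IH by (auto intro!: exI[of _ "\<lambda>x. f' x + g' x"] derivative_eq_intros)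
qed simp

lemma differentiable_times_mult:
  "differentiable_times n f \<Longrightarrow> differentiable_times n g \<Longrightarrow>
     differentiable_times n (\<lambda>x. f x * g x)"
proof (induction n arbitrary: f g)
  case (Suc n)
  obtain f' g' where *:
    "\<forall>x. (f has_real_derivative f' x) (at x)" "differentiable_times n f'"
    "\<forall>x. (g has_real_derivative g' x) (at x)" "differentiable_times n g'"
    using Suc.prems by auto
  have "differentiable_times n (\<lambda>x. f' x * g x + f x * g' x)"
    using * Suc.IH Suc.prems[THEN differentiable_times_decrease]
    by (intro differentiable_times_add) auto
  with * show ?case
    by (auto intro!: exI[of _ "\<lambda>x. f' x * g x + f x * g' x"] derivative_eq_intros)
qed simp

text \<open>
  The constant factor \<open>c\<close> makes the induction close: differentiation turns it into \<open>c * d\<close>.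
\<close>

lemma differentiable_times_affine:
  "differentiable_times n f \<Longrightarrow> differentiable_times n (\<lambda>x. c * f (d * x + a))"
proof (induction n arbitrary: f c)
  case (Suc n)
  obtain f' where *:
    "\<forall>x. (f has_real_derivative f' x) (at x)" "differentiable_times n f'"
    using Suc.prems by auto
  have "((\<lambda>x. c * f (d * x + a)) has_real_derivative (c * d) * f' (d * x + a)) (at x)" for x
  proof -
    have "((\<lambda>x. d * x + a) has_real_derivative d) (at x)"
      by (auto intro!: derivative_eq_intros)
    with *(1) have "((\<lambda>x. f (d * x + a)) has_real_derivative f' (d * x + a) * d) (at x)"
      by (intro DERIV_chain2[where f = f and g = "\<lambda>x. d * x + a"]) auto
    from DERIV_cmult[OF this, of c] show ?thesis by (simp add: mult_ac)
  qed
  with Suc.IH[OF *(2), of "c * d"] show ?case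
    by (auto intro!: exI[of _ "\<lambda>x. (c * d) * f' (d * x + a)"])
qed simp

lemma deriv_eq_fun:
  assumes "\<forall>x. (f has_real_derivative f' x) (at x)"
  shows "deriv f = f'"
  using assms by (auto intro: DERIV_imp_deriv)

lemma differentiable_times_imp_higher_deriv:
  "differentiable_times (Suc n) f \<Longrightarrow> (deriv ^^ n) f differentiable_on UNIV"
proof (induction n arbitrary: f)
  case 0
  then show ?case
    by (auto simp: differentiable_on_def real_differentiable_def)
next
  case (Suc n)
  then obtain f' where f': "\<forall>x. (f has_real_derivative f' x) (at x)"
      "differentiable_times (Suc n) f'"
    by (metis differentiable_times.simps(2))
  have "(deriv ^^ Suc n) f = (deriv ^^ n) f'"
    unfolding funpow_Suc_right comp_def using deriv_eq_fun[OF f'(1)] by simp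
  with Suc.IH[OF f'(2)] show ?case by simp
qed

lemma higher_deriv_imp_differentiable_times:
  "\<forall>k<n. (deriv ^^ k) f differentiable_on UNIV \<Longrightarrow> differentiable_times n f"
proof (induction n arbitrary: f)
  case (Suc n)
  have "f differentiable_on UNIV" using Suc.prems by fastforce
  hence "\<forall>x. (f has_real_derivative deriv f x) (at x)"
    by (simp add: differentiable_on_def real_differentiable_def) (metis DERIV_imp_deriv)
  moreover have "differentiable_times n (deriv f)"
  proof (rule Suc.IH, intro allI impI)
    fix k assume "k < n"
    hence "(deriv ^^ Suc k) f differentiable_on UNIV" using Suc.prems by blast
    thus "(deriv ^^ k) (deriv f) differentiable_on UNIV" by (simp only: funpow_Suc_right comp_def)
  qed
  ultimately show ?case by auto
qed simp

definition smooth :: "(real \<Rightarrow> real) \<Rightarrow> bool" where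
  "smooth f \<longleftrightarrow> (\<forall>n. differentiable_times n f)"

lemma smooth_iff_higher_deriv:
  "smooth f \<longleftrightarrow> (\<forall>n. (deriv ^^ n) f differentiable_on UNIV)"
  unfolding smooth_def
  using differentiable_times_imp_higher_deriv higher_deriv_imp_differentiable_times by blast

lemma smooth_antiderivative:
  assumes "\<And>x. (f has_real_derivative g x) (at x)" and "smooth g"
  shows "smooth f"
  unfolding smooth_def
proof
  fix n show "differentiable_times n f"
    using assms by (cases n) (auto simp: smooth_def)
qed

lemma smooth_has_deriv:
  assumes "smooth f"
  shows "(f has_real_derivative deriv f x) (at x)"
proof -
  have "differentiable_times (Suc 0) f" using assms smooth_def by blast
  then obtain f' where "\<forall>x. (f has_real_derivative f' x) (at x)" by auto
  with deriv_eq_fun show ?thesis by metis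
qed

lemma smooth_imp_continuous_deriv:
  assumes "smooth f"
  shows "continuous_on UNIV (deriv f)"
proof -
  have "(deriv ^^ Suc 0) f differentiable_on UNIV"
    using assms smooth_iff_higher_deriv by blast
  thus ?thesis by (simp add: differentiable_imp_continuous_on)
qed

lemma smooth_affine:
  assumes "smooth f"
  shows "smooth (\<lambda>x. c * f (d * x + a))"
  unfolding smooth_def
proof
  fix n show "differentiable_times n (\<lambda>x. c * f (d * x + a))"
    using assms differentiable_times_affine[of n f c d a] by (simp add: smooth_def)
qed

lemma smooth_add:
  assumes "smooth f" "smooth g"
  shows "smooth (\<lambda>x. f x + g x)"
  unfolding smooth_def
proof
  fix n show "differentiable_times n (\<lambda>x. f x + g x)"
    using assms by (intro differentiable_times_add) (simp_all add: smooth_def)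
qed

lemma smooth_mult:
  assumes "smooth f" "smooth g"
  shows "smooth (\<lambda>x. f x * g x)"
  unfolding smooth_def
proof
  fix n show "differentiable_times n (\<lambda>x. f x * g x)"
    using assms by (intro differentiable_times_mult) (simp_all add: smooth_def)
qed

lemma smooth_shift: "smooth f \<Longrightarrow> smooth (\<lambda>x. f (x - a))"
  using smooth_affine[of f 1 1 "- a"] by simp

lemma smooth_diff:
  assumes "smooth f" "smooth g"
  shows "smooth (\<lambda>x. f x - g x)"
  using smooth_add[OF assms(1) smooth_affine[OF assms(2), of "- 1" 1 0]] by simp

section \<open>Bump functions\<close>

text \<open>
  The polynomial \<open>p = 1\<close> gives the classical flat function; carrying an arbitrary \<open>p\<close> makes
  the family closed under differentiation.
\<close>

definition flat :: "real poly \<Rightarrow> real \<Rightarrow> real" where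
  "flat p x = (if x > 0 then poly p (1 / x) * exp (- (1 / x)) else 0)"

lemma poly_times_exp_neg_tendsto_0:
  fixes p :: "real poly"
  shows "((\<lambda>t. poly p t * exp (- t)) \<longlongrightarrow> 0) at_top"
proof -
  have "((\<lambda>t. \<Sum>i\<le>degree p. coeff p i * (t ^ i / exp t)) \<longlongrightarrow> (\<Sum>i\<le>degree p. coeff p i * 0)) at_top"
    by (intro tendsto_intros tendsto_power_div_exp_0)
  also have "(\<lambda>t. \<Sum>i\<le>degree p. coeff p i * (t ^ i / exp t)) = (\<lambda>t. poly p t * exp (- t))"
    by (simp add: poly_altdef exp_minus field_simps sum_distrib_left sum_divide_distrib)
  finally show ?thesis by simp
qed

text \<open>
  The new polynomial is \<open>X\<^sup>2 (p - p')\<close>: the chain rule through \<open>1 / x\<close> contributes \<open>- X\<^sup>2\<close>, and the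
  outer derivative of \<open>p(t) exp (- t)\<close> contributes \<open>p' - p\<close>.
  At \<open>0\<close> the right difference quotient is \<open>t p(t) exp (- t)\<close> with \<open>t = 1 / x\<close>, which vanishes as \<open>t\<close> grows.
\<close>

lemma flat_has_derivative:
  "(flat p has_real_derivative flat ([:0, 0, 1:] * (p - pderiv p)) x) (at x)"
proof -
  consider "x > 0" | "x < 0" | "x = 0" by linarith
  thus ?thesis
  proof cases
    case 1
    have "((\<lambda>x. poly p (1 / x) * exp (- (1 / x))) has_real_derivative
        flat ([:0, 0, 1:] * (p - pderiv p)) x) (at x)"
      using 1 by (auto intro!: derivative_eq_intros DERIV_chain2[OF poly_DERIV]
          simp: flat_def field_simps power2_eq_square)
    moreover have "\<forall>\<^sub>F y in nhds x. flat p y = poly p (1 / y) * exp (- (1 / y))"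
      using eventually_nhds_in_open[of "{0<..}" x] 1
      by (auto elim!: eventually_mono simp: flat_def)
    ultimately show ?thesis by (metis DERIV_cong_ev)
  next
    case 2
    have "\<forall>\<^sub>F y in nhds x. flat p y = 0"
      using eventually_nhds_in_open[of "{..<0}" x] 2
      by (auto elim!: eventually_mono simp: flat_def)
    hence "(flat p has_real_derivative 0) (at x) \<longleftrightarrow> ((\<lambda>_. 0) has_real_derivative 0) (at x)"
      by (rule DERIV_cong_ev[OF refl _ refl])
    moreover have "flat ([:0, 0, 1:] * (p - pderiv p)) x = 0"
      unfolding flat_def using 2 by (metis less_asym)
    ultimately show ?thesis by (metis DERIV_const)
  next
    case 3
    have "((\<lambda>y. flat p y / y) \<longlongrightarrow> 0) (at 0)"
    proof (rule filterlim_split_at)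
      have "\<forall>\<^sub>F y in at_left 0. flat p y / y = 0"
        by (auto simp: eventually_at_filter flat_def)
      thus "((\<lambda>y. flat p y / y) \<longlongrightarrow> 0) (at_left 0)" by (rule tendsto_eventually)
      have "((\<lambda>y. poly ([:0, 1:] * p) (inverse y) * exp (- inverse y)) \<longlongrightarrow> 0) (at_right 0)"
        using filterlim_compose[OF poly_times_exp_neg_tendsto_0 filterlim_inverse_at_top_right] .
      moreover have "\<forall>\<^sub>F y in at_right 0.
          poly ([:0, 1:] * p) (inverse y) * exp (- inverse y) = flat p y / y"
        by (auto simp: eventually_at_filter flat_def field_simps)
      ultimately show "((\<lambda>y. flat p y / y) \<longlongrightarrow> 0) (at_right 0)"
        by (rule Lim_transform_eventually)
    qed
    thus ?thesis using 3 by (simp add: has_field_derivative_iff flat_def)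
  qed
qed

lemma smooth_flat: "smooth (flat p)"
proof -
  have "differentiable_times n (flat p)" for n
  proof (induction n arbitrary: p)
    case (Suc n)
    then show ?case using flat_has_derivative by auto
  qed simp
  thus ?thesis by (simp add: smooth_def)
qed

lemma exists_bump:
  fixes d :: real
  assumes "d > 0"
  obtains \<rho> where "smooth \<rho>" "\<And>x. \<rho> x \<ge> 0" "\<And>x. 0 < x \<Longrightarrow> x < d \<Longrightarrow> \<rho> x > 0"
    "\<And>x. x \<notin> {0<..<d} \<Longrightarrow> \<rho> x = 0"
proof
  \<comment> \<open>The factors \<open>1\<close> and \<open>- 1\<close> are kept to match the affine form in \<open>smooth_affine\<close>.\<close>
  let ?\<rho> = "\<lambda>x. flat 1 x * (1 * flat 1 ((- 1) * x + d))"
  show "smooth ?\<rho>"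
    using smooth_mult[OF smooth_flat[of 1] smooth_affine[OF smooth_flat[of 1], of 1 "- 1" d]] .
qed (auto simp: flat_def)

text \<open>
  The step is an antiderivative of a bump: it is constant where the bump vanishes and rises
  strictly where the bump is positive.
\<close>

lemma exists_smooth_step:
  fixes d :: real
  assumes "d > 0"
  obtains R \<rho> where "\<And>x. (R has_real_derivative \<rho> x) (at x)" "smooth R" "continuous_on UNIV \<rho>"
    "\<And>x. \<rho> x \<ge> 0" "\<forall>x. x \<notin> {0..d} \<longrightarrow> \<rho> x = 0"
    "\<And>x. x \<le> 0 \<Longrightarrow> R x = R 0" "\<And>x. x \<ge> d \<Longrightarrow> R x = R d" "R 0 < R d"
proof -
  obtain \<rho> where \<rho>: "smooth \<rho>" "\<And>x. \<rho> x \<ge> 0" "\<And>x. 0 < x \<Longrightarrow> x < d \<Longrightarrow> \<rho> x > 0"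
    "\<And>x. x \<notin> {0<..<d} \<Longrightarrow> \<rho> x = 0" by (rule exists_bump[OF assms]) blast
  have cont: "continuous_on UNIV \<rho>"
    using smooth_has_deriv[OF \<rho>(1)] DERIV_isCont continuous_at_imp_continuous_on by blast
  hence "isCont \<rho> x" for x by (simp add: continuous_on_eq_continuous_at)
  then obtain R where "\<forall>x. - \<infinity> < ereal x \<longrightarrow> ereal x < \<infinity> \<longrightarrow> (R has_vector_derivative \<rho> x) (at x)"
    using einterval_antiderivative[of "- \<infinity>" \<infinity> \<rho>] by auto
  hence R: "(R has_real_derivative \<rho> x) (at x)" for x
    by (simp add: has_real_derivative_iff_has_vector_derivative)
  have contR: "continuous_on A R" for A
    using R DERIV_isCont continuous_at_imp_continuous_on by blast
  show thesis
  proof (rule that[of R \<rho>])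
    show "smooth R" by (rule smooth_antiderivative[OF R \<rho>(1)])
    have const: "R y = R x" if "x \<le> y" "\<And>t. x < t \<Longrightarrow> t < y \<Longrightarrow> \<rho> t = 0" for x y
    proof (cases "x = y")
      case False
      hence "x < y" using that(1) by simp
      moreover have "(R has_real_derivative 0) (at t)" if "x < t" "t < y" for t
        using R[of t] \<open>\<And>t. x < t \<Longrightarrow> t < y \<Longrightarrow> \<rho> t = 0\<close>[OF that] by simp
      ultimately show ?thesis
        using contR[of "{x..y}"] by (intro DERIV_isconst_end) auto
    qed simp
    show "R x = R 0" if "x \<le> 0" for x
      by (rule const[symmetric]) (use that \<rho>(4) in simp_all)
    show "R x = R d" if "x \<ge> d" for x
      by (rule const) (use that \<rho>(4) in simp_all)
    show "R 0 < R d"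
      by (rule DERIV_pos_imp_increasing_open[OF assms _ contR]) (use R \<rho>(3) in blast)
  qed (use R cont \<rho> in auto)
qed

section \<open>Test functions\<close>

lemma test_functionI:
  assumes "smooth \<phi>" and "\<And>x. x \<notin> {a..b} \<Longrightarrow> \<phi> x = 0"
  shows "\<phi> \<in> test_functions"
proof -
  have "closure {x. \<phi> x \<noteq> 0} \<subseteq> {a..b}"
    by (rule closure_minimal) (use assms(2) in \<open>blast | simp\<close>)+
  hence "compact (closure {x. \<phi> x \<noteq> 0})"
    by (metis closed_closure compact_Icc compact_Int_closed inf.absorb_iff2)
  thus ?thesis using assms(1) by (simp add: test_functions_def smooth_iff_higher_deriv)
qed

lemma test_function_smooth: "\<phi> \<in> test_functions \<Longrightarrow> smooth \<phi>"
  by (simp add: test_functions_def smooth_iff_higher_deriv)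

text \<open>
  Off the support a test function vanishes on a neighbourhood, so one interval serves for both
  the function and its derivative. This turns integrals over the line into integrals over a
  compact interval.
\<close>

lemma test_function_support:
  assumes "\<phi> \<in> test_functions"
  obtains a b where "\<And>x. x \<notin> {a..b} \<Longrightarrow> \<phi> x = 0" "\<And>x. x \<notin> {a..b} \<Longrightarrow> deriv \<phi> x = 0"
proof -
  have "bounded (closure {x. \<phi> x \<noteq> 0})"
    using assms by (auto simp: test_functions_def compact_imp_bounded)
  hence "bounded {x. \<phi> x \<noteq> 0}" using bounded_subset closure_subset by blast
  then obtain a b where "{x. \<phi> x \<noteq> 0} \<subseteq> cbox a b"
    using bounded_subset_cbox_symmetric by blast
  hence *: "\<phi> x = 0" if "x \<notin> {a..b}" for x using that by auto
  have "deriv \<phi> x = 0" if "x \<notin> {a..b}" for x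
  proof -
    have "open (- {a..b})" by (simp add: open_Compl)
    hence "\<forall>\<^sub>F y in nhds x. \<phi> y = 0"
      using eventually_nhds_in_open[of "- {a..b}" x] that *
      by (auto elim!: eventually_mono)
    hence "(\<phi> has_real_derivative 0) (at x) \<longleftrightarrow> ((\<lambda>_. 0) has_real_derivative 0) (at x)"
      by (rule DERIV_cong_ev[OF refl _ refl])
    thus ?thesis using DERIV_const DERIV_imp_deriv by blast
  qed
  with * show thesis by (rule that)
qed

lemma translate_test_function:
  assumes "\<phi> \<in> test_functions"
  shows "translate x \<phi> \<in> test_functions"
proof -
  obtain a b where "\<And>y. y \<notin> {a..b} \<Longrightarrow> \<phi> y = 0" "\<And>y. y \<notin> {a..b} \<Longrightarrow> deriv \<phi> y = 0"
    by (rule test_function_support[OF assms]) blast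
  hence "translate x \<phi> y = 0" if "y \<notin> {a + x..b + x}" for y
    using that by (auto simp: translate_def)
  moreover have "smooth (translate x \<phi>)"
    unfolding translate_def by (rule smooth_shift[OF test_function_smooth[OF assms]])
  ultimately show ?thesis using test_functionI[of "translate x \<phi>" "a + x" "b + x"] by blast
qed

lemma deriv_translate:
  assumes "\<phi> \<in> test_functions"
  shows "deriv (translate x \<phi>) y = deriv \<phi> (y - x)"
proof -
  have "((\<lambda>y. \<phi> (y + - x)) has_real_derivative deriv \<phi> (y + - x)) (at y)"
    using smooth_has_deriv[OF test_function_smooth[OF assms], of "y + - x"]
    by (simp only: DERIV_shift)
  thus ?thesis
    unfolding translate_def by (intro DERIV_imp_deriv) simp
qed

lemma integrable_times_deriv_test:
  assumes "continuous_on UNIV F" "\<phi> \<in> test_functions"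
  shows "(\<lambda>x. F x * deriv \<phi> x) integrable_on UNIV"
proof -
  obtain a b where "\<And>x. x \<notin> {a..b} \<Longrightarrow> \<phi> x = 0"
    and ab: "\<And>x. x \<notin> {a..b} \<Longrightarrow> deriv \<phi> x = 0"
    by (rule test_function_support[OF assms(2)]) blast
  have "continuous_on {a..b} (\<lambda>x. F x * deriv \<phi> x)"
    using assms(1) smooth_imp_continuous_deriv[OF test_function_smooth[OF assms(2)]]
    by (intro continuous_intros) (auto intro: continuous_on_subset)
  hence "(\<lambda>x. F x * deriv \<phi> x) integrable_on {a..b}"
    by (rule integrable_continuous_interval)
  thus ?thesis
    by (rule integrable_on_superset) (use ab in auto)
qed

lemma integral_UNIV_eq_on_support:
  fixes f :: "real \<Rightarrow> real"
  assumes "\<And>x. x \<notin> A \<Longrightarrow> f x = 0"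
  shows "integral UNIV f = integral A f"
proof -
  have "(\<lambda>x. if x \<in> A then f x else 0) = f" using assms by auto
  thus ?thesis using integral_restrict_UNIV[of A f] by simp
qed

section \<open>Uniqueness of the primitive\<close>

text \<open>
  The bump \<open>\<rho>\<close> translated to \<open>{a..a + d}\<close> acts as a weight of total mass \<open>R d - R 0\<close>, so a bound for \<open>F\<close>
  on that interval bounds the weighted integral.
\<close>

lemma integral_bump_bounds:
  fixes F R \<rho> :: "real \<Rightarrow> real"
  assumes F: "continuous_on UNIV F" and R: "\<And>x. (R has_real_derivative \<rho> x) (at x)"
    and \<rho>: "continuous_on UNIV \<rho>" "\<And>x. \<rho> x \<ge> 0" "\<forall>x. x \<notin> {0..d} \<longrightarrow> \<rho> x = 0"
    and "d > 0"
  shows "(\<lambda>x. F x * \<rho> (x - a)) integrable_on UNIV"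
    and "(\<And>x. x \<in> {a..a + d} \<Longrightarrow> F x \<le> c) \<Longrightarrow>
      integral UNIV (\<lambda>x. F x * \<rho> (x - a)) \<le> c * (R d - R 0)"
    and "(\<And>x. x \<in> {a..a + d} \<Longrightarrow> c \<le> F x) \<Longrightarrow>
      c * (R d - R 0) \<le> integral UNIV (\<lambda>x. F x * \<rho> (x - a))"
proof -
  have "continuous_on {a..a + d} (\<lambda>x. F x * \<rho> (x - a))"
    using F by (intro continuous_intros continuous_on_compose2[OF \<rho>(1)])
      (auto intro: continuous_on_subset)
  hence int: "(\<lambda>x. F x * \<rho> (x - a)) integrable_on {a..a + d}"
    by (rule integrable_continuous_interval)
  have "((\<lambda>x. F x * \<rho> (x - a)) has_integral integral {a..a + d} (\<lambda>x. F x * \<rho> (x - a))) UNIV"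
    by (rule has_integral_on_superset[OF integrable_integral[OF int]]) (use \<rho>(3) in auto)
  hence eq: "integral UNIV (\<lambda>x. F x * \<rho> (x - a)) = integral {a..a + d} (\<lambda>x. F x * \<rho> (x - a))"
    and "(\<lambda>x. F x * \<rho> (x - a)) integrable_on UNIV"
    by (auto simp: integral_unique)
  thus "(\<lambda>x. F x * \<rho> (x - a)) integrable_on UNIV" by blast
  have "((\<lambda>x. \<rho> (x - a)) has_integral (R (a + d - a) - R (a - a))) {a..a + d}"
  proof (rule fundamental_theorem_of_calculus)
    fix x
    have "((\<lambda>x. R (x + - a)) has_real_derivative \<rho> (x + - a)) (at x)"
      using R[of "x + - a"] by (simp only: DERIV_shift)
    thus "((\<lambda>x. R (x - a)) has_vector_derivative \<rho> (x - a)) (at x within {a..a + d})"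
      by (auto simp: has_real_derivative_iff_has_vector_derivative
          intro: has_vector_derivative_at_within)
  qed (use \<open>d > 0\<close> in simp)
  from has_integral_mult_right[OF this]
  have base: "((\<lambda>x. c * \<rho> (x - a)) has_integral c * (R d - R 0)) {a..a + d}" by simp
  show "integral UNIV (\<lambda>x. F x * \<rho> (x - a)) \<le> c * (R d - R 0)"
    if "\<And>x. x \<in> {a..a + d} \<Longrightarrow> F x \<le> c"
    unfolding eq
    by (rule has_integral_le[OF integrable_integral[OF int] base])
      (use that \<rho>(2) in \<open>auto intro: mult_right_mono\<close>)
  show "c * (R d - R 0) \<le> integral UNIV (\<lambda>x. F x * \<rho> (x - a))"
    if "\<And>x. x \<in> {a..a + d} \<Longrightarrow> c \<le> F x"
    unfolding eq
    by (rule has_integral_le[OF base integrable_integral[OF int]])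
      (use that \<rho>(2) in \<open>auto intro: mult_right_mono\<close>)
qed

text \<open>
  If \<open>F a < F b\<close>, then \<open>F\<close> stays below a constant just right of \<open>a\<close> and above a larger one just right
  of \<open>b\<close>. The weighted averages of \<open>F\<close> over these two places would differ, but the test function
  \<open>R (x - a) - R (x - b)\<close> forces them to be equal. This holds whichever of \<open>a\<close> and \<open>b\<close>
  lies to the left, so both strict inequalities between \<open>F a\<close> and \<open>F b\<close> are excluded.
\<close>

lemma du_Bois_Reymond:
  assumes F: "continuous_on UNIV F"
    and zero: "\<And>\<phi>. \<phi> \<in> test_functions \<Longrightarrow> integral UNIV (\<lambda>x. F x * deriv \<phi> x) = 0"
  shows "F a = F b"
proof -
  have "\<not> F a < F b" for a b
  proof
    assume less: "F a < F b"
    \<comment> \<open>A third of the gap, so that \<open>F a + e < F b - e\<close>.\<close>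
    define e where "e = (F b - F a) / 3"
    have "e > 0" using less by (simp add: e_def)
    have "isCont F a" "isCont F b" using F by (simp_all add: continuous_on_eq_continuous_at)
    with \<open>e > 0\<close> obtain da db where da: "da > 0" "\<And>x. \<bar>x - a\<bar> < da \<Longrightarrow> \<bar>F x - F a\<bar> < e"
      and db: "db > 0" "\<And>x. \<bar>x - b\<bar> < db \<Longrightarrow> \<bar>F x - F b\<bar> < e"
      by (metis continuous_at_eps_delta dist_real_def)
    define d where "d = min da db / 2"
    have d: "d > 0" "d < da" "d < db" using da(1) db(1) by (auto simp: d_def)
    obtain R \<rho> where R: "\<And>x. (R has_real_derivative \<rho> x) (at x)" "smooth R"
      and \<rho>: "continuous_on UNIV \<rho>" "\<And>x. \<rho> x \<ge> 0" "\<forall>x. x \<notin> {0..d} \<longrightarrow> \<rho> x = 0"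
      and step: "\<And>x. x \<le> 0 \<Longrightarrow> R x = R 0" "\<And>x. x \<ge> d \<Longrightarrow> R x = R d" "R 0 < R d"
      by (rule exists_smooth_step[OF d(1)]) blast
    define \<phi> where "\<phi> = (\<lambda>x. R (x - a) - R (x - b))"
    have "\<phi> \<in> test_functions"
    proof (rule test_functionI)
      show "smooth \<phi>" unfolding \<phi>_def by (rule smooth_diff[OF smooth_shift[OF R(2)] smooth_shift[OF R(2)]])
      fix x assume "x \<notin> {min a b..max a b + d}"
      \<comment> \<open>Left of both points and right of both steps the two translates take the same value.\<close>
      hence "x - a \<le> 0 \<and> x - b \<le> 0 \<or> x - a \<ge> d \<and> x - b \<ge> d" by auto
      thus "\<phi> x = 0" unfolding \<phi>_def using step(1,2) by (metis diff_self)
    qed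
    moreover have "deriv \<phi> x = \<rho> (x - a) - \<rho> (x - b)" for x
    proof (rule DERIV_imp_deriv)
      have "((\<lambda>x. R (x + - c)) has_real_derivative \<rho> (x + - c)) (at x)" for c
        using R(1)[of "x + - c"] by (simp only: DERIV_shift)
      thus "(\<phi> has_real_derivative \<rho> (x - a) - \<rho> (x - b)) (at x)"
        unfolding \<phi>_def by (auto intro!: DERIV_diff)
    qed
    ultimately have "integral UNIV (\<lambda>x. F x * \<rho> (x - a) - F x * \<rho> (x - b)) = 0"
      using zero[of \<phi>] by (simp add: right_diff_distrib)
    hence "integral UNIV (\<lambda>x. F x * \<rho> (x - a)) = integral UNIV (\<lambda>x. F x * \<rho> (x - b))"
      unfolding integral_diff[OF integral_bump_bounds(1)[OF F R(1) \<rho> d(1)]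
          integral_bump_bounds(1)[OF F R(1) \<rho> d(1)]] by simp
    moreover have "integral UNIV (\<lambda>x. F x * \<rho> (x - a)) \<le> (F a + e) * (R d - R 0)"
    proof (rule integral_bump_bounds(2)[OF F R(1) \<rho> d(1)])
      fix x assume "x \<in> {a..a + d}"
      with da(2)[of x] d show "F x \<le> F a + e" by auto
    qed
    moreover have "(F b - e) * (R d - R 0) \<le> integral UNIV (\<lambda>x. F x * \<rho> (x - b))"
    proof (rule integral_bump_bounds(3)[OF F R(1) \<rho> d(1)])
      fix x assume "x \<in> {b..b + d}"
      with db(2)[of x] d show "F b - e \<le> F x" by auto
    qed
    ultimately have "(F b - e) * (R d - R 0) \<le> (F a + e) * (R d - R 0)" by linarith
    hence "F b - e \<le> F a + e" using step(3) by simp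
    thus False using less by (simp add: e_def field_simps)
  qed
  thus ?thesis by (metis linorder_neqE)
qed

text \<open>
  The difference of two primitives is constant, and the common limit \<open>0\<close> at minus infinity fixes
  the constant.
\<close>

lemma has_dist_deriv_unique:
  assumes "F \<in> C_tilde" "G \<in> C_tilde" "has_dist_deriv F f" "has_dist_deriv G f"
  shows "F = G"
proof
  fix x
  have cont: "continuous_on UNIV F" "continuous_on UNIV G"
    and lim: "(F \<longlongrightarrow> 0) at_bot" "(G \<longlongrightarrow> 0) at_bot"
    using assms(1,2) by (auto simp: C_tilde_def)
  have "F y - G y = F x - G x" for y
  proof (rule du_Bois_Reymond[where F = "\<lambda>x. F x - G x"])
    show "continuous_on UNIV (\<lambda>x. F x - G x)" using cont by (intro continuous_intros)
    fix \<phi> assume \<phi>: "\<phi> \<in> test_functions"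
    hence "integral UNIV (\<lambda>x. F x * deriv \<phi> x) = integral UNIV (\<lambda>x. G x * deriv \<phi> x)"
      using assms(3,4) by (auto simp: has_dist_deriv_def)
    thus "integral UNIV (\<lambda>x. (F x - G x) * deriv \<phi> x) = 0"
      using \<phi> cont by (simp add: left_diff_distrib integral_diff integrable_times_deriv_test)
  qed
  hence "(\<lambda>y. F y - G y) = (\<lambda>y. F x - G x)" by blast
  moreover have "((\<lambda>y. F y - G y) \<longlongrightarrow> 0 - 0) at_bot" using lim by (intro tendsto_intros)
  ultimately have "((\<lambda>y::real. F x - G x) \<longlongrightarrow> 0) at_bot" by simp
  hence "F x - G x = 0" by (simp add: tendsto_const_iff)
  thus "F x = G x" by simp
qed

lemma primitive_eq:
  assumes "F \<in> C_tilde" "has_dist_deriv F f"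
  shows "primitive f = F"
  unfolding primitive_def using assms has_dist_deriv_unique by blast

section \<open>Continuity of translation\<close>

lemma C_tilde_diff:
  assumes "F \<in> C_tilde" "G \<in> C_tilde"
  shows "(\<lambda>x. F x - G x) \<in> C_tilde"
proof -
  obtain L M where "(F \<longlongrightarrow> L) at_top" "(G \<longlongrightarrow> M) at_top" using assms by (auto simp: C_tilde_def)
  hence "((\<lambda>x. F x - G x) \<longlongrightarrow> L - M) at_top" by (rule tendsto_diff)
  moreover have "((\<lambda>x. F x - G x) \<longlongrightarrow> 0 - 0) at_bot"
    using assms by (intro tendsto_diff) (auto simp: C_tilde_def)
  ultimately show ?thesis
    using assms by (auto simp: C_tilde_def intro: continuous_on_diff)
qed

lemma C_tilde_translate:
  assumes "F \<in> C_tilde"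
  shows "translate x F \<in> C_tilde"
proof -
  obtain L where L: "(F \<longlongrightarrow> L) at_top" and bot: "(F \<longlongrightarrow> 0) at_bot" and cont: "continuous_on UNIV F"
    using assms by (auto simp: C_tilde_def)
  have "filterlim (\<lambda>y. y - x) at_top at_top"
    unfolding filterlim_at_top
  proof
    fix Z show "\<forall>\<^sub>F y in at_top. Z \<le> y - x"
      using eventually_ge_at_top[of "Z + x"] by eventually_elim simp
  qed
  hence "(translate x F \<longlongrightarrow> L) at_top" unfolding translate_def by (rule filterlim_compose[OF L])
  moreover have "filterlim (\<lambda>y. y - x) at_bot at_bot"
    unfolding filterlim_at_bot
  proof
    fix Z show "\<forall>\<^sub>F y in at_bot. y - x \<le> Z"
      using eventually_le_at_bot[of "Z + x"] by eventually_elim simp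
  qed
  hence "(translate x F \<longlongrightarrow> 0) at_bot" unfolding translate_def by (rule filterlim_compose[OF bot])
  moreover have "continuous_on UNIV (translate x F)"
    unfolding translate_def
    by (intro continuous_on_compose2[OF cont] continuous_intros) auto
  ultimately show ?thesis by (auto simp: C_tilde_def)
qed

lemma has_dist_deriv_diff:
  assumes "continuous_on UNIV F" "continuous_on UNIV G" "has_dist_deriv F f" "has_dist_deriv G g"
  shows "has_dist_deriv (\<lambda>x. F x - G x) (f - g)"
  using assms
  by (simp add: has_dist_deriv_def left_diff_distrib integral_diff integrable_times_deriv_test)

text \<open>
  The translation passes from the test function to \<open>F\<close> by the substitution \<open>y \<mapsto> y - x\<close> in the
  integral, carried out on a compact interval containing the support.
\<close>

lemma has_dist_deriv_translate:
  assumes "has_dist_deriv F f"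
  shows "has_dist_deriv (translate x F) (translate_dist x f)"
  unfolding has_dist_deriv_def
proof
  fix \<phi> assume \<phi>: "\<phi> \<in> test_functions"
  have "translate_dist x f \<phi> = - integral UNIV (\<lambda>y. F y * deriv \<phi> (y + x))"
    using assms translate_test_function[OF \<phi>, of "- x"] deriv_translate[OF \<phi>, of "- x"]
    by (simp add: translate_dist_def has_dist_deriv_def)
  also have "integral UNIV (\<lambda>y. F y * deriv \<phi> (y + x)) =
      integral UNIV (\<lambda>y. translate x F y * deriv \<phi> y)"
  proof -
    obtain a b where "\<And>y. y \<notin> {a..b} \<Longrightarrow> \<phi> y = 0"
      and ab: "\<And>y. y \<notin> {a..b} \<Longrightarrow> deriv \<phi> y = 0"
      by (rule test_function_support[OF \<phi>]) blast
    have "integral UNIV (\<lambda>y. F y * deriv \<phi> (y + x)) =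
        integral {a - x..b - x} (\<lambda>y. F y * deriv \<phi> (y + x))"
      by (intro integral_UNIV_eq_on_support) (use ab in auto)
    also have "\<dots> = integral {a..b} (\<lambda>y. translate x F y * deriv \<phi> y)"
      using integral_shift_real_ivl[of a x b "\<lambda>y. translate x F y * deriv \<phi> y"]
      by (simp add: translate_def)
    also have "\<dots> = integral UNIV (\<lambda>y. translate x F y * deriv \<phi> y)"
      by (intro integral_UNIV_eq_on_support[symmetric]) (use ab in auto)
    finally show ?thesis .
  qed
  finally show "translate_dist x f \<phi> = - integral UNIV (\<lambda>y. translate x F y * deriv \<phi> y)" .
qed

text \<open>
  Near either end of the line \<open>F\<close> is within \<open>e / 2\<close> of its limit; the compact rest is handled by
  the Heine-Cantor theorem.
\<close>

lemma C_tilde_uniformly_continuous: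
  assumes "F \<in> C_tilde" "e > 0"
  obtains d where "d > 0" "\<And>x y. \<bar>x - y\<bar> < d \<Longrightarrow> \<bar>F x - F y\<bar> < e"
proof -
  obtain L where L: "(F \<longlongrightarrow> L) at_top" and bot: "(F \<longlongrightarrow> 0) at_bot" and cont: "continuous_on UNIV F"
    using assms by (auto simp: C_tilde_def)
  have "e / 2 > 0" using assms by simp
  from tendstoD[OF L this] obtain B where B: "\<And>x. x \<ge> B \<Longrightarrow> \<bar>F x - L\<bar> < e / 2"
    by (auto simp: eventually_at_top_linorder dist_real_def)
  from tendstoD[OF bot \<open>e / 2 > 0\<close>] obtain A where A: "\<And>x. x \<le> A \<Longrightarrow> \<bar>F x\<bar> < e / 2"
    by (auto simp: eventually_at_bot_linorder dist_real_def)
  have "uniformly_continuous_on {A - 1..B + 1} F"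
    using cont by (intro compact_uniformly_continuous) (auto intro: continuous_on_subset)
  then obtain d where d: "d > 0"
    "\<And>x y. x \<in> {A - 1..B + 1} \<Longrightarrow> y \<in> {A - 1..B + 1} \<Longrightarrow> \<bar>x - y\<bar> < d \<Longrightarrow> \<bar>F x - F y\<bar> < e"
    using assms(2) unfolding uniformly_continuous_on_def dist_real_def by metis
  show thesis
  proof
    \<comment> \<open>Points less than \<open>1\<close> apart both lie in one tail or both lie in the enlarged interval.\<close>
    show "min d 1 > 0" using d(1) by simp
    fix x y assume xy: "\<bar>x - y\<bar> < min d 1"
    then consider "x \<le> A" "y \<le> A" | "x \<ge> B" "y \<ge> B" | "x \<in> {A - 1..B + 1}" "y \<in> {A - 1..B + 1}"
      by (smt (verit) atLeastAtMost_iff)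
    thus "\<bar>F x - F y\<bar> < e"
    proof cases
      case 1
      then show ?thesis using A[of x] A[of y] by linarith
    next
      case 2
      then show ?thesis using B[of x] B[of y] by linarith
    next
      case 3
      then show ?thesis using d(2) xy by simp
    qed
  qed
qed

text \<open>
  The term at minus infinity in the definition of the integral is the limit of \<open>F\<close> there, which is \<open>0\<close>.
\<close>

lemma alexiewicz_norm_eq:
  assumes "F \<in> C_tilde" "has_dist_deriv F f"
  shows "alexiewicz_norm f = (SUP x. \<bar>F x\<bar>)"
proof -
  have "Lim at_bot F = 0"
    using assms(1) by (auto simp: C_tilde_def intro: tendsto_Lim)
  thus ?thesis
    by (simp add: alexiewicz_norm_def dist_integral_def ext_val_def primitive_eq[OF assms]
        flip: MInfty_eq_minfinity)
qed

theorem corollary2: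
  fixes f :: "(real \<Rightarrow> real) \<Rightarrow> real"
  assumes "f \<in> dist_A"
  shows "((\<lambda>x. alexiewicz_norm (translate_dist x f - f)) \<longlongrightarrow> 0) (at 0)"
proof -
  obtain F where F: "F \<in> C_tilde" "has_dist_deriv F f"
    using assms by (auto simp: dist_A_def)
  have norm: "alexiewicz_norm (translate_dist x f - f) = (SUP y. \<bar>F (y - x) - F y\<bar>)" for x
  proof -
    have "(\<lambda>y. translate x F y - F y) \<in> C_tilde"
      using F(1) C_tilde_translate C_tilde_diff by blast
    moreover have "has_dist_deriv (\<lambda>y. translate x F y - F y) (translate_dist x f - f)"
      using F C_tilde_translate[OF F(1), of x]
      by (intro has_dist_deriv_diff has_dist_deriv_translate) (auto simp: C_tilde_def)
    ultimately show ?thesis by (simp add: alexiewicz_norm_eq translate_def)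
  qed
  show ?thesis
  proof (rule tendstoI)
    fix e :: real assume "e > 0"
    then obtain d where d: "d > 0" "\<And>x y. \<bar>x - y\<bar> < d \<Longrightarrow> \<bar>F x - F y\<bar> < e / 2"
      using C_tilde_uniformly_continuous[OF F(1), of "e / 2"] by auto
    have "\<bar>alexiewicz_norm (translate_dist x f - f)\<bar> < e" if "\<bar>x\<bar> < d" for x
    proof -
      have le: "\<bar>F (y - x) - F y\<bar> \<le> e / 2" for y
        using d(2)[of "y - x" y] that by simp
      hence "(SUP y. \<bar>F (y - x) - F y\<bar>) \<le> e / 2" by (intro cSUP_least) auto
      moreover have "0 \<le> (SUP y. \<bar>F (y - x) - F y\<bar>)"
        by (rule cSUP_upper2[OF bdd_aboveI2[OF le], of 0]) auto
      ultimately show ?thesis using \<open>e > 0\<close> by (simp add: norm)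
    qed
    with d(1) show "\<forall>\<^sub>F x in at 0. dist (alexiewicz_norm (translate_dist x f - f)) 0 < e"
      by (auto simp: eventually_at dist_real_def)
  qed
qed

end
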